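(* Let $n\ge 1$, $m\ge 0$ be integers, $Q\in\mathbb{R}^{n\times n}$ symmetric, $c\in\mathbb{R}^n$, $A\in\mathbb{R}^{m\times n}$, $b\in\mathbb{R}^m$ and $B\subseteq\{1,\dots,n\}$. Consider the associated mixed-binary quadratic program (MBQP), completely positive program (CPP), and dual copositive program (COP) defined in the context. If the feasible region of (MBQP) is nonempty and bounded, then strong duality holds between (CPP) and (COP), i.e. the optimal value (minimum) of (CPP) equals the optimal value (supremum) of (COP).
   Context: Notation: $\langle M,N\rangle=\mathrm{Tr}(M^\top N)$; $A_{i,*}$ is the $i$th row of $A$ (a $1\times n$ matrix); $e_j\in\mathbb{R}^n$ is the $j$th standard basis (column) vector. Block matrices below are $(n+1)\times(n+1)$ with blocks of sizes $n\times n$, $n\times 1$, $1\times n$, $1\times 1$. Cones: the completely positive cone is $\mathcal{C}^*_{N}=\{X\in\mathbb{R}^{N\times N}\mid X=\sum_k x^{(k)}(x^{(k)})^\top \text{ (finite sum)},\ x^{(k)}\in\mathbb{R}^N_{\ge 0}\}$, and the copositive cone is $\mathcal{C}_{N}=\{X\in\mathbb{R}^{N\times N}\mid v^\top Xv\ge 0\ \ \forall v\in\mathbb{R}^N_{\ge 0}\}$. (MBQP): minimize $x^\top Qx+2c^\top x$ over $x\in\mathbb{R}^n$ subject to $Ax=b$, $x\ge 0$ (entrywise), and $x_j\in\{0,1\}$ for $j\in B$. (CPP): minimize $\left\langle \begin{pmatrix}Q&c\\ c^\top&0\end{pmatrix},Y\right\rangle$ over $X\in\mathbb{R}^{n\times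 n}$, $x\in\mathbb{R}^n$, where $Y=\begin{pmatrix}X&x\\ x^\top&1\end{pmatrix}$, subject to $\left\langle \begin{pmatrix}0&\frac12A_{i,*}^\top\\ \frac12A_{i,*}&0\end{pmatrix},Y\right\rangle=b_i$ and $\left\langle \begin{pmatrix}A_{i,*}^\top A_{i,*}&0\\ 0&0\end{pmatrix},Y\right\rangle=b_i^2$ for $i=1,\dots,m$; $\left\langle \begin{pmatrix}-e_je_j^\top&\frac12e_j\\ \frac12e_j^\top&0\end{pmatrix},Y\right\rangle=0$ for $j\in B$; and $Y\in\mathcal{C}^*_{n+1}$. (COP): maximize $\gamma+\sum_{i=1}^m\left(\mu^{(\mathrm{lin})}_ib_i+\mu^{(\mathrm{quad})}_ib_i^2\right)$ over $\mu=(\mu^{(\mathrm{lin})},\mu^{(\mathrm{quad})})\in\mathbb{R}^m\times\mathbb{R}^m$, $\lambda\in\mathbb{R}^B$, $\gamma\in\mathbb{R}$ subject to $M(\mu,\lambda,\gamma)\in\mathcal{C}_{n+1}$, where $$M(\mu,\lambda,\gamma)=\begin{pmatrix}Q&c\\ c^\top&0\end{pmatrix}-\sum_{i=1}^m\mu^{(\mathrm{lin})}_i\begin{pmatrix}0&\frac12A_{i,*}^\top\\ \frac12A_{i,*}&0\end{pmatrix}-\sum_{i=1}^m\mu^{(\mathrm{quad})}_i\begin{pmatrix}A_{i,*}^\top A_{i,*}&0\\ 0&0\end{pmatrix}-\sum_{j\in B}\lambda_j\begin{pmatrix}-e_je_j^\top&\frac12e_j\\ \frac12e_j^\top&0\end{pmatrix}-\gamma\begin{pmatrix}0&0\\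 0&1\end{pmatrix}.$$ *)

theory Defs
  imports "HOL-Analysis.Analysis"
begin

definition frob :: "real^'n^'m \<Rightarrow> real^'n^'m \<Rightarrow> real"
  where "frob M N = trace (transpose M ** N)"

definition block :: "real^'q^'p \<Rightarrow> real^'s^'p \<Rightarrow> real^'q^'r \<Rightarrow> real^'s^'r \<Rightarrow> real^('q + 's)^('p + 'r)"
  where "block M N P R =
    (\<chi> i j. case i of
        Inl i' \<Rightarrow> (case j of Inl j' \<Rightarrow> M $ i' $ j' | Inr j' \<Rightarrow> N $ i' $ j')
      | Inr i' \<Rightarrow> (case j of Inl j' \<Rightarrow> P $ i' $ j' | Inr j' \<Rightarrow> R $ i' $ j'))"

definition nonneg_vec :: "real^'k \<Rightarrow> bool"
  where "nonneg_vec v \<longleftrightarrow> (\<forall>i. 0 \<le> v $ i)"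

definition completely_positive :: "(real^'k^'k) set"
  where "completely_positive =
    {X. \<exists>(K::nat) (x :: nat \<Rightarrow> real^'k). (\<forall>k<K. nonneg_vec (x k)) \<and>
        X = (\<Sum>k<K. columnvector (x k) ** (rowvector (x k) :: real^'k^1))}"

definition copositive :: "(real^'k^'k) set"
  where "copositive = {X. \<forall>v. nonneg_vec v \<longrightarrow> 0 \<le> v \<bullet> (X *v v)}"

text \<open>
  The dimension \<open>n\<close> is the cardinality of the index type \<open>'n\<close>, and \<open>n + 1\<close> that of
  \<open>'n + 1\<close>, where \<open>1\<close> is the one-element type. Since \<open>m = 0\<close> is allowed, the
  \<open>m \<times> n\<close> matrix \<open>A\<close> is given by its rows \<open>A i\<close> and \<open>b\<close> by its entries \<open>b i\<close>,
  for \<open>i \<in> {1..m}\<close>; values at other indices are never used. Likewise the multipliers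
  \<open>\<mu>l, \<mu>q\<close> (for the linear and the quadratic constraints) only matter on \<open>{1..m}\<close>
  and \<open>\<nu>\<close> (for the binary constraints) only on \<open>B\<close>.
\<close>

definition mbqp_feasible :: "nat \<Rightarrow> (nat \<Rightarrow> real^'n) \<Rightarrow> (nat \<Rightarrow> real) \<Rightarrow> ('n::finite) set \<Rightarrow> (real^'n) set"
  where "mbqp_feasible m A b B =
    {x. (\<forall>i\<in>{1..m}. A i \<bullet> x = b i) \<and> nonneg_vec x \<and> (\<forall>j\<in>B. x $ j \<in> {0, 1})}"

definition obj_mat :: "real^'n^'n \<Rightarrow> real^'n \<Rightarrow> real^('n + 1)^('n + 1)"
  where "obj_mat Q c = block Q (columnvector c) (rowvector c) 0"

definition lin_mat :: "real^'n \<Rightarrow> real^('n + 1)^('n + 1)"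
  where "lin_mat a = block 0 ((1/2) *\<^sub>R columnvector a) ((1/2) *\<^sub>R rowvector a) 0"

definition quad_mat :: "real^'n \<Rightarrow> real^('n + 1)^('n + 1)"
  where "quad_mat a = block (columnvector a ** (rowvector a :: real^'n^1)) 0 0 0"

definition bin_mat :: "'n::finite \<Rightarrow> real^('n + 1)^('n + 1)"
  where "bin_mat j =
    (let e = axis j 1 :: real^'n in
      block (- (columnvector e ** (rowvector e :: real^'n^1)))
            ((1/2) *\<^sub>R columnvector e) ((1/2) *\<^sub>R rowvector e) 0)"

definition corner_mat :: "real^('n::finite + 1)^('n + 1)"
  where "corner_mat = block 0 0 0 (mat 1)"

definition lifted :: "real^'n^'n \<Rightarrow> real^'n \<Rightarrow> real^('n + 1)^('n + 1)"
  where "lifted X x = block X (columnvector x) (rowvector x) (mat 1)"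

definition cpp_feasible ::
    "nat \<Rightarrow> (nat \<Rightarrow> real^'n) \<Rightarrow> (nat \<Rightarrow> real) \<Rightarrow> ('n::finite) set \<Rightarrow> ((real^'n^'n) \<times> (real^'n)) set"
  where "cpp_feasible m A b B =
    {(X, x). (\<forall>i\<in>{1..m}. frob (lin_mat (A i)) (lifted X x) = b i
                        \<and> frob (quad_mat (A i)) (lifted X x) = (b i)\<^sup>2)
           \<and> (\<forall>j\<in>B. frob (bin_mat j) (lifted X x) = 0)
           \<and> lifted X x \<in> completely_positive}"

definition cpp_obj :: "real^'n^'n \<Rightarrow> real^'n \<Rightarrow> (real^'n^'n) \<times> (real^'n) \<Rightarrow> real"
  where "cpp_obj Q c = (\<lambda>(X, x). frob (obj_mat Q c) (lifted X x))"

definition cpp_value ::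
    "real^'n^'n \<Rightarrow> real^'n \<Rightarrow> nat \<Rightarrow> (nat \<Rightarrow> real^'n) \<Rightarrow> (nat \<Rightarrow> real) \<Rightarrow> ('n::finite) set \<Rightarrow> ereal"
  where "cpp_value Q c m A b B = (INF p\<in>cpp_feasible m A b B. ereal (cpp_obj Q c p))"

definition dual_mat ::
    "real^'n^'n \<Rightarrow> real^'n \<Rightarrow> nat \<Rightarrow> (nat \<Rightarrow> real^'n) \<Rightarrow> ('n::finite) set \<Rightarrow>
     (nat \<Rightarrow> real) \<Rightarrow> (nat \<Rightarrow> real) \<Rightarrow> ('n::finite \<Rightarrow> real) \<Rightarrow> real \<Rightarrow> real^('n + 1)^('n + 1)"
  where "dual_mat Q c m A B \<mu>l \<mu>q \<nu> \<gamma> =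
      obj_mat Q c
    - (\<Sum>i=1..m. \<mu>l i *\<^sub>R lin_mat (A i))
    - (\<Sum>i=1..m. \<mu>q i *\<^sub>R quad_mat (A i))
    - (\<Sum>j\<in>B. \<nu> j *\<^sub>R bin_mat j)
    - \<gamma> *\<^sub>R corner_mat"

definition cop_feasible ::
    "real^'n^'n \<Rightarrow> real^'n \<Rightarrow> nat \<Rightarrow> (nat \<Rightarrow> real^'n) \<Rightarrow> ('n::finite) set \<Rightarrow>
     ((nat \<Rightarrow> real) \<times> (nat \<Rightarrow> real) \<times> ('n::finite \<Rightarrow> real) \<times> real) set"
  where "cop_feasible Q c m A B =
    {(\<mu>l, \<mu>q, \<nu>, \<gamma>). dual_mat Q c m A B \<mu>l \<mu>q \<nu> \<gamma> \<in> copositive}"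

definition cop_obj ::
    "nat \<Rightarrow> (nat \<Rightarrow> real) \<Rightarrow> (nat \<Rightarrow> real) \<times> (nat \<Rightarrow> real) \<times> ('n \<Rightarrow> real) \<times> real \<Rightarrow> real"
  where "cop_obj m b = (\<lambda>(\<mu>l, \<mu>q, \<nu>, \<gamma>). \<gamma> + (\<Sum>i=1..m. \<mu>l i * b i + \<mu>q i * (b i)\<^sup>2))"

definition cop_value ::
    "real^'n^'n \<Rightarrow> real^'n \<Rightarrow> nat \<Rightarrow> (nat \<Rightarrow> real^'n) \<Rightarrow> (nat \<Rightarrow> real) \<Rightarrow> ('n::finite) set \<Rightarrow> ereal"
  where "cop_value Q c m A b B = (SUP q\<in>cop_feasible Q c m A B. ereal (cop_obj m b q))"

end

theory Submission
  imports Defs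
begin

text \<open>
  Both programs are an instance of linear optimisation over the closed convex cone of completely
  positive matrices, whose dual cone is the copositive cone
  (\<open>copositive_iff_dual_completely_positive\<close>): (CPP) minimises a linear functional over the
  matrices \<open>Y\<close> in the cone with \<open>C k \<bullet> Y = d k\<close> for finitely many \<open>k\<close>, the condition that the
  last diagonal entry of \<open>Y\<close> is 1 being one of these equations with multiplier \<open>\<gamma>\<close>, and (COP) is
  its Lagrangian dual.
  
  Conic duality can fail when the image of the cone under
  \<open>Y \<mapsto> (obj \<bullet> Y, (C k \<bullet> Y)\<^sub>k)\<close> is not closed. It is closed as soon as no nonzero \<open>Y\<close> in the
  cone satisfies the homogeneous equations \<open>C k \<bullet> Y = 0\<close>, for then it is generated by a compact set
  that avoids the origin. Given closedness, the minimum is attained, and every point with a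
  smaller objective value is separated from the image by a hyperplane, whose normal consists of dual
  multipliers (\<open>conic_strong_duality\<close>).
  
  A feasible point of (MBQP) lifts to one of (CPP), and boundedness of (MBQP) yields the kernel condition
  (\<open>cpp_kernel_trivial\<close>). If \<open>Y = \<Sum>k. z k (z k)\<^sup>T\<close> with \<open>z k \<ge> 0\<close> solves the homogeneous
  equations, then the corner equation makes the last entry of every \<open>z k\<close> vanish, the quadratic
  equations give \<open>A i \<bullet> r = 0\<close> for the remaining part \<open>r\<close> of \<open>z k\<close>, and the binary equations give
  \<open>r $ j = 0\<close> for \<open>j \<in> B\<close>. Such an \<open>r \<ge> 0\<close> can be added to a feasible point of (MBQP) any number
  of times without leaving the feasible region; as that region is nonempty and bounded, \<open>r = 0\<close>.
\<close>

section \<open>Strong duality over closed convex cones\<close>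

text \<open>
  The slice of \<open>K\<close> by the unit sphere is compact and generates \<open>K\<close>; the kernel condition says that its
  image avoids 0, so that the conic hull of this image is closed.
\<close>
lemma closed_linear_image_convex_cone:
  fixes f :: "'a::euclidean_space \<Rightarrow> 'b::euclidean_space"
  assumes K: "closed K" "convex_cone K" and f: "linear f"
    and ker: "\<And>Y. Y \<in> K \<Longrightarrow> f Y = 0 \<Longrightarrow> Y = 0"
  shows "closed (f ` K)"
proof (cases "K \<subseteq> {0}")
  case True
  then have "f ` K = {0}"
    using convex_cone_contains_0[OF K(2)] linear_0[OF f] by auto
  then show ?thesis by simp
next
  case False
  define S where "S = K \<inter> sphere 0 1"
  have S: "compact S"
    unfolding S_def using K(1) by (simp add: closed_Int_compact)
  have "K \<subseteq> conic hull S"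
  proof
    fix Y assume Y: "Y \<in> K"
    show "Y \<in> conic hull S"
    proof (cases "Y = 0")
      case True
      obtain Z where Z: "Z \<in> K" "Z \<noteq> 0" using False by auto
      then have "(1 / norm Z) *\<^sub>R Z \<in> S"
        unfolding S_def using convex_cone_scaleR[OF K(2)] by simp
      then have "0 *\<^sub>R ((1 / norm Z) *\<^sub>R Z) \<in> conic hull S"
        unfolding conic_hull_explicit by blast
      then show ?thesis using True by simp
    next
      case False
      then have "(1 / norm Y) *\<^sub>R Y \<in> S"
        unfolding S_def using convex_cone_scaleR[OF K(2)] Y by simp
      moreover have "Y = norm Y *\<^sub>R ((1 / norm Y) *\<^sub>R Y)"
        using False by simp
      ultimately show ?thesis
        unfolding conic_hull_explicit using norm_ge_zero[of Y] by blast
    qed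
  qed
  moreover have "conic hull S \<subseteq> K"
    using K(2) by (intro hull_minimal) (auto simp: S_def convex_cone_def)
  ultimately have "f ` K = conic hull (f ` S)"
    by (simp add: conic_hull_linear_image[OF f] subset_antisym)
  moreover have "compact (f ` S)"
    using S f by (intro compact_continuous_image linear_continuous_on) (auto simp: linear_linear)
  moreover have "0 \<notin> f ` S"
    using ker unfolding S_def by force
  ultimately show ?thesis
    by (simp add: closed_conic_hull_strong)
qed

lemma separate_point_from_closed_convex_cone:
  fixes D :: "'a::euclidean_space set"
  assumes D: "closed D" "convex_cone D" and "z \<notin> D"
  obtains a where "a \<bullet> z < 0" "\<And>x. x \<in> D \<Longrightarrow> 0 \<le> a \<bullet> x"
proof -
  have "convex D" using D(2) by (simp add: convex_cone_def)
  then obtain a \<beta> where a: "a \<bullet> z < \<beta>" "\<And>x. x \<in> D \<Longrightarrow> \<beta> < a \<bullet> x"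
    using separating_hyperplane_closed_point[of D z] D(1) assms(3) by auto
  have "\<beta> < 0" using a(2)[OF convex_cone_contains_0[OF D(2)]] by simp
  have "0 \<le> a \<bullet> x" if x: "x \<in> D" for x
  proof (rule ccontr)
    assume neg: "\<not> 0 \<le> a \<bullet> x"
    \<comment> \<open>Scaling \<open>x\<close> until it meets the hyperplane \<open>a \<bullet> y = \<beta>\<close> contradicts the separation.\<close>
    have "(\<beta> / (a \<bullet> x)) *\<^sub>R x \<in> D"
      using neg \<open>\<beta> < 0\<close> x by (intro convex_cone_scaleR[OF D(2)]) (auto simp: zero_le_divide_iff)
    from a(2)[OF this] show False using neg by simp
  qed
  with a(1) \<open>\<beta> < 0\<close> show ?thesis by (intro that[of a]) auto
qed

text \<open>
  The set \<open>D\<close> of all pairs of objective value and constraint values over \<open>K\<close> is a closed convex cone.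
  Its lowest point above the prescribed constraint values is the primal minimum, and each functional
  separating a lower point from \<open>D\<close> is, after division by its positive coefficient of the objective,
  a dual solution of correspondingly large value. The dual supremum is approached within any \<open>e\<close>,
  but may not be attained.
  
  The constraint values are stored as the single vector \<open>G Y = (\<Sum>k\<in>I. (C k \<bullet> Y) *\<^sub>R C k)\<close> of the
  ambient space instead of a tuple indexed by \<open>I\<close>. This loses nothing, since
  \<open>Y \<bullet> G Y = (\<Sum>k\<in>I. (C k \<bullet> Y)\<^sup>2)\<close> gives \<open>G\<close> exactly the common kernel of the constraints, and it
  lets \<open>I\<close> be an arbitrary finite set.
\<close>
theorem conic_strong_duality:
  fixes K :: "'a::euclidean_space set" and C :: "'i \<Rightarrow> 'a" and d :: "'i \<Rightarrow> real"
  assumes K: "closed K" "convex_cone K" and "finite I"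
    and ker: "\<forall>Y\<in>K. (\<forall>k\<in>I. C k \<bullet> Y = 0) \<longrightarrow> Y = 0"
    and Y0: "Y0 \<in> K" "\<forall>k\<in>I. C k \<bullet> Y0 = d k"
  obtains Ymin where "Ymin \<in> K" "\<forall>k\<in>I. C k \<bullet> Ymin = d k"
    "\<forall>Y\<in>K. (\<forall>k\<in>I. C k \<bullet> Y = d k) \<longrightarrow> obj \<bullet> Ymin \<le> obj \<bullet> Y"
    "\<forall>e>0. \<exists>\<mu>. (\<forall>Y\<in>K. 0 \<le> (obj - (\<Sum>k\<in>I. \<mu> k *\<^sub>R C k)) \<bullet> Y)
                       \<and> obj \<bullet> Ymin - e < (\<Sum>k\<in>I. \<mu> k * d k)"
proof -
  define G where "G Y = (\<Sum>k\<in>I. (C k \<bullet> Y) *\<^sub>R C k)" for Y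
  define T where "T Y = (obj \<bullet> Y, G Y)" for Y
  have linG: "linear G"
    unfolding G_def by (intro linearI) (simp_all add: inner_add_right scaleR_add_left
        sum.distrib scaleR_sum_right)
  have linT: "linear T"
    unfolding T_def by (intro linearI)
      (simp_all add: inner_add_right linear_add[OF linG] linear_scale[OF linG])
  have inner_G: "w \<bullet> G Y = (\<Sum>k\<in>I. (w \<bullet> C k) * (C k \<bullet> Y))" for w Y
    unfolding G_def by (simp add: inner_sum_right mult.commute)
  have G0: "\<forall>k\<in>I. C k \<bullet> Y = 0" if "G Y = 0" for Y
  proof -
    have "(\<Sum>k\<in>I. (C k \<bullet> Y)\<^sup>2) = Y \<bullet> G Y"
      unfolding inner_G by (simp add: power2_eq_square inner_commute)
    then show ?thesis
      using that \<open>finite I\<close> by (simp add: sum_nonneg_eq_0_iff)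
  qed
  have G_eq: "\<forall>k\<in>I. C k \<bullet> Y = d k" if "G Y = G Y0" for Y
  proof -
    have "G (Y - Y0) = 0" using that by (simp add: linear_diff[OF linG])
    from G0[OF this] show ?thesis using Y0(2) by (simp add: inner_diff_right)
  qed
  define D where "D = T ` K"
  have D: "closed D" "convex_cone D"
  proof -
    have "Y = 0" if "Y \<in> K" "T Y = 0" for Y
    proof -
      have "G Y = 0" using that(2) by (simp add: T_def zero_prod_def)
      from G0[OF this] show ?thesis using ker that(1) by blast
    qed
    then show "closed D"
      unfolding D_def using K linT by (rule_tac closed_linear_image_convex_cone) auto
    show "convex_cone D"
      unfolding D_def using K(2) linT by (simp add: convex_cone_linear_image)
  qed
  \<comment> \<open>A functional that separates \<open>(r, G Y0)\<close> from \<open>D\<close> and is positive on the objective axis, rescaled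
    to have coefficient 1 there, is a dual solution of value above \<open>r\<close>.\<close>
  have dual: "\<exists>\<mu>. (\<forall>Y\<in>K. 0 \<le> (obj - (\<Sum>k\<in>I. \<mu> k *\<^sub>R C k)) \<bullet> Y) \<and> s * r < s * (\<Sum>k\<in>I. \<mu> k * d k)"
    if a: "(s, w) \<bullet> (r, G Y0) < 0" "\<And>x. x \<in> D \<Longrightarrow> 0 \<le> (s, w) \<bullet> x" and s: "0 < s" for s w r
  proof -
    define \<mu> where "\<mu> k = - (w \<bullet> C k) / s" for k
    have eq: "(s, w) \<bullet> T Y = s * ((obj - (\<Sum>k\<in>I. \<mu> k *\<^sub>R C k)) \<bullet> Y)" for Y
      using s unfolding T_def \<mu>_def
      by (simp add: inner_G inner_add_left inner_sum_left distrib_left sum_distrib_left sum_negf)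
    have "0 \<le> (obj - (\<Sum>k\<in>I. \<mu> k *\<^sub>R C k)) \<bullet> Y" if "Y \<in> K" for Y
    proof -
      have "0 \<le> (s, w) \<bullet> T Y" using that a(2) by (simp add: D_def)
      then show ?thesis using s by (simp add: eq zero_le_mult_iff)
    qed
    moreover have "s * (\<Sum>k\<in>I. \<mu> k * d k) = - (w \<bullet> G Y0)"
      using s Y0(2) by (simp add: \<mu>_def inner_G sum_distrib_left sum_negf)
    ultimately show ?thesis using a(1) by (intro exI[of _ \<mu>]) auto
  qed
  define R where "R = {r. (r, G Y0) \<in> D}"
  have R0: "obj \<bullet> Y0 \<in> R" using Y0(1) by (auto simp: R_def D_def T_def)
  have "closed R"
  proof -
    have "closed ((\<lambda>r. (r, G Y0)) -` D)"
      using D(1) by (intro closed_vimage) (auto intro!: continuous_intros)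
    then show ?thesis by (simp add: R_def vimage_def)
  qed
  have "\<exists>\<mu>. \<forall>Y\<in>K. 0 \<le> (obj - (\<Sum>k\<in>I. \<mu> k *\<^sub>R C k)) \<bullet> Y"
  proof -
    \<comment> \<open>The direction \<open>(-1, 0)\<close>, in which the objective falls while all constraint values stay fixed,
      is outside \<open>D\<close>; a functional that separates it has a positive coefficient on the objective axis.\<close>
    have "(-1, 0) \<notin> D"
    proof
      assume "(-1, 0) \<in> D"
      then obtain Y where Y: "Y \<in> K" "obj \<bullet> Y = -1" "G Y = 0"
        by (auto simp: D_def T_def)
      have "Y = 0" using ker Y(1) G0[OF Y(3)] by blast
      with Y(2) show False by simp
    qed
    from separate_point_from_closed_convex_cone[OF D this]
    obtain a where a: "a \<bullet> (-1, 0) < 0" "\<And>x. x \<in> D \<Longrightarrow> 0 \<le> a \<bullet> x" by blast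
    obtain s w where sw: "a = (s, w)" by (cases a)
    have s: "0 < s" using a(1) by (simp add: sw)
    \<comment> \<open>The separating functional takes the value \<open>-1\<close> at \<open>(r, G Y0)\<close>.\<close>
    define r where "r = (- (w \<bullet> G Y0) - 1) / s"
    have "(s, w) \<bullet> (r, G Y0) < 0" using s by (simp add: r_def)
    from dual[OF this _ s] a(2) show ?thesis unfolding sw by blast
  qed
  then obtain \<mu> where \<mu>: "\<And>Y. Y \<in> K \<Longrightarrow> 0 \<le> (obj - (\<Sum>k\<in>I. \<mu> k *\<^sub>R C k)) \<bullet> Y" by blast
  have "bdd_below R"
  proof (rule bdd_belowI)
    fix r assume "r \<in> R"
    then obtain Y where Y: "Y \<in> K" "obj \<bullet> Y = r" "G Y = G Y0"
      by (auto simp: R_def D_def T_def)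
    show "(\<Sum>k\<in>I. \<mu> k * d k) \<le> r"
      using \<mu>[OF Y(1)] G_eq[OF Y(3)] Y(2) by (simp add: inner_diff_left inner_sum_left)
  qed
  then have "Inf R \<in> R" using closed_contains_Inf[of R] R0 \<open>closed R\<close> by auto
  then obtain Ymin where Ymin: "Ymin \<in> K" "obj \<bullet> Ymin = Inf R" "G Ymin = G Y0"
    by (auto simp: R_def D_def T_def)
  show ?thesis
  proof
    show "Ymin \<in> K" "\<forall>k\<in>I. C k \<bullet> Ymin = d k" using Ymin G_eq by auto
    show "\<forall>Y\<in>K. (\<forall>k\<in>I. C k \<bullet> Y = d k) \<longrightarrow> obj \<bullet> Ymin \<le> obj \<bullet> Y"
    proof (intro ballI impI)
      fix Y assume Y: "Y \<in> K" "\<forall>k\<in>I. C k \<bullet> Y = d k"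
      have "G Y = G Y0" using Y(2) Y0(2) by (simp add: G_def)
      then have "T Y = (obj \<bullet> Y, G Y0)" by (simp add: T_def)
      then have "obj \<bullet> Y \<in> R" using Y(1) unfolding R_def D_def by (metis imageI mem_Collect_eq)
      then show "obj \<bullet> Ymin \<le> obj \<bullet> Y" using \<open>bdd_below R\<close> by (simp add: Ymin(2) cInf_lower)
    qed
    show "\<forall>e>0. \<exists>\<mu>. (\<forall>Y\<in>K. 0 \<le> (obj - (\<Sum>k\<in>I. \<mu> k *\<^sub>R C k)) \<bullet> Y)
            \<and> obj \<bullet> Ymin - e < (\<Sum>k\<in>I. \<mu> k * d k)"
    proof (intro allI impI)
      fix e :: real assume "0 < e"
      have "(obj \<bullet> Ymin - e, G Y0) \<notin> D"
      proof
        assume "(obj \<bullet> Ymin - e, G Y0) \<in> D"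
        then have "Inf R \<le> obj \<bullet> Ymin - e" using \<open>bdd_below R\<close> by (intro cInf_lower) (simp_all add: R_def)
        then show False using \<open>0 < e\<close> by (simp add: Ymin(2))
      qed
      from separate_point_from_closed_convex_cone[OF D this]
      obtain a where a: "a \<bullet> (obj \<bullet> Ymin - e, G Y0) < 0" "\<And>x. x \<in> D \<Longrightarrow> 0 \<le> a \<bullet> x" by blast
      obtain s w where sw: "a = (s, w)" by (cases a)
      \<comment> \<open>The functional is nonnegative at the attained point \<open>(obj \<bullet> Ymin, G Y0)\<close> and negative \<open>e\<close>
        below it, so the separating hyperplane is not vertical.\<close>
      have s: "0 < s"
      proof -
        have "T Ymin \<in> D" using Ymin(1) by (simp add: D_def)
        from a(2)[OF this] have "0 \<le> s * (obj \<bullet> Ymin) + w \<bullet> G Y0"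
          by (simp add: sw T_def Ymin(3))
        moreover have "s * (obj \<bullet> Ymin - e) + w \<bullet> G Y0 < 0" using a(1) by (simp add: sw)
        ultimately have "0 < s * e" by (simp add: algebra_simps)
        then show ?thesis using \<open>0 < e\<close> by (simp add: zero_less_mult_iff)
      qed
      from dual[OF _ _ s, of w "obj \<bullet> Ymin - e"] a
      show "\<exists>\<mu>. (\<forall>Y\<in>K. 0 \<le> (obj - (\<Sum>k\<in>I. \<mu> k *\<^sub>R C k)) \<bullet> Y)
              \<and> obj \<bullet> Ymin - e < (\<Sum>k\<in>I. \<mu> k * d k)"
        using s unfolding sw by (auto simp: mult_less_cancel_left_pos)
    qed
  qed
qed

section \<open>The completely positive cone\<close>

abbreviation outer :: "real^'k \<Rightarrow> real^'k^'k"
  where "outer z \<equiv> columnvector z ** (rowvector z :: real^'k^1)"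

lemma columnvector_nth [simp]: "columnvector v $ i $ j = v $ i"
  by (simp add: columnvector_def)

lemma rowvector_nth [simp]: "rowvector v $ i $ j = v $ j"
  by (simp add: rowvector_def)

lemma outer_nth [simp]: "outer z $ i $ j = z $ i * z $ j"
  by (simp add: matrix_matrix_mult_def)

lemma outer_scaleR: "outer (t *\<^sub>R z) = t\<^sup>2 *\<^sub>R outer z"
  by (simp add: vec_eq_iff power2_eq_square mult.left_commute)

lemma frob_eq_inner: "frob M N = M \<bullet> N"
  unfolding frob_def trace_def matrix_matrix_mult_def transpose_def inner_vec_def
  by (simp, subst sum.swap) simp

lemma inner_outer: "M \<bullet> outer z = z \<bullet> (M *v z)"
  by (simp add: inner_vec_def matrix_vector_mult_def sum_distrib_left mult_ac)

lemma zero_completely_positive: "0 \<in> completely_positive"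
  unfolding completely_positive_def by (auto intro!: exI[of _ 0])

lemma completely_positive_add_outer:
  fixes z :: "real^'k"
  assumes "X \<in> completely_positive" "nonneg_vec z"
  shows "X + outer z \<in> completely_positive"
proof -
  obtain K and x :: "nat \<Rightarrow> real^'k" where x: "\<forall>k<K. nonneg_vec (x k)" "X = (\<Sum>k<K. outer (x k))"
    using assms(1) by (auto simp: completely_positive_def)
  have "X + outer z = (\<Sum>k<Suc K. outer ((x(K := z)) k))" using x(2) by simp
  moreover have "\<forall>k<Suc K. nonneg_vec ((x(K := z)) k)" using x(1) assms(2) by (simp add: less_Suc_eq)
  ultimately show ?thesis unfolding completely_positive_def by blast
qed

lemma outer_completely_positive: "nonneg_vec z \<Longrightarrow> outer z \<in> completely_positive"
  using completely_positive_add_outer[OF zero_completely_positive, of z] by simp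

lemma completely_positive_induct [consumes 1, case_names zero add_outer]:
  fixes X :: "real^'k^'k"
  assumes "X \<in> completely_positive" and "P 0"
    and step: "\<And>X z. X \<in> completely_positive \<Longrightarrow> P X \<Longrightarrow> nonneg_vec z \<Longrightarrow> P (X + outer z)"
  shows "P X"
proof -
  obtain K and x :: "nat \<Rightarrow> real^'k" where x: "\<forall>k<K. nonneg_vec (x k)" "X = (\<Sum>k<K. outer (x k))"
    using assms(1) by (auto simp: completely_positive_def)
  have "L \<le> K \<Longrightarrow> (\<Sum>k<L. outer (x k)) \<in> completely_positive \<and> P (\<Sum>k<L. outer (x k))" for L
    by (induction L) (auto simp: zero_completely_positive assms(2) x(1)
        intro: completely_positive_add_outer step)
  then show ?thesis using x(2) by blast
qed

lemma convex_cone_completely_positive: "convex_cone completely_positive"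
  unfolding convex_cone_iff
proof (intro conjI ballI allI impI)
  show "0 \<in> completely_positive" by (rule zero_completely_positive)
  show "X + Y \<in> completely_positive" if "X \<in> completely_positive" "Y \<in> completely_positive"
    for X Y :: "real^'k^'k"
    using that(2,1)
    by (induction rule: completely_positive_induct)
      (auto simp: add.assoc[symmetric] intro: completely_positive_add_outer)
  show "t *\<^sub>R X \<in> completely_positive" if "X \<in> completely_positive" "0 \<le> t"
    for X :: "real^'k^'k" and t
    using that(1)
  proof (induction rule: completely_positive_induct)
    case zero
    show ?case by (simp add: zero_completely_positive)
  next
    case (add_outer X z)
    have "t *\<^sub>R (X + outer z) = t *\<^sub>R X + outer (sqrt t *\<^sub>R z)"
      using \<open>0 \<le> t\<close> by (simp add: outer_scaleR scaleR_add_right)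
    moreover have "nonneg_vec (sqrt t *\<^sub>R z)"
      using add_outer \<open>0 \<le> t\<close> by (simp add: nonneg_vec_def)
    ultimately show ?case using add_outer completely_positive_add_outer by metis
  qed
qed

text \<open>
  The cone is generated by the matrices \<open>outer z\<close> with \<open>z\<close> nonnegative of norm 1. These form a compact
  set, and the convex hull of this set is compact and avoids 0, so the cone over it is closed.
\<close>
lemma closed_completely_positive: "closed (completely_positive :: (real^'k^'k) set)"
proof -
  define Z :: "(real^'k) set" where "Z = {z. nonneg_vec z} \<inter> sphere 0 1"
  define S where "S = outer ` Z"
  have "closed {z :: real^'k. nonneg_vec z}"
    unfolding nonneg_vec_def by (intro closed_Collect_all closed_Collect_le continuous_intros)
  then have "compact Z" unfolding Z_def by (simp add: closed_Int_compact)
  moreover have "continuous_on Z outer"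
    unfolding matrix_matrix_mult_def columnvector_def rowvector_def by (simp, intro continuous_intros)
  ultimately have "compact S" unfolding S_def by (intro compact_continuous_image)
  have "S \<noteq> {}"
  proof -
    have "axis undefined 1 \<in> Z" by (auto simp: Z_def nonneg_vec_def axis_def norm_axis_1[unfolded axis_def])
    then show ?thesis by (auto simp: S_def)
  qed
  have "completely_positive = convex_cone hull S"
  proof
    show "convex_cone hull S \<subseteq> completely_positive"
      by (rule hull_minimal) (auto simp: S_def Z_def outer_completely_positive convex_cone_completely_positive)
    show "completely_positive \<subseteq> convex_cone hull S"
    proof
      fix X :: "real^'k^'k" assume "X \<in> completely_positive"
      then show "X \<in> convex_cone hull S"
      proof (induction rule: completely_positive_induct)
        case zero
        show ?case by (rule convex_cone_hull_contains_0)
      next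
        case (add_outer X z)
        have "outer z \<in> convex_cone hull S"
        proof (cases "z = 0")
          case True
          then have "outer z = 0" by (simp add: vec_eq_iff)
          then show ?thesis by (simp only: convex_cone_hull_contains_0)
        next
          case False
          have "outer ((1 / norm z) *\<^sub>R z) \<in> convex_cone hull S"
            using False add_outer by (intro hull_inc) (simp add: S_def Z_def nonneg_vec_def)
          then have "(norm z)\<^sup>2 *\<^sub>R outer ((1 / norm z) *\<^sub>R z) \<in> convex_cone hull S"
            by (rule convex_cone_hull_mul) simp
          then show ?thesis using False by (simp add: outer_scaleR power_divide)
        qed
        then show ?case using add_outer by (simp add: convex_cone_hull_add)
      qed
    qed
  qed
  moreover have "0 \<notin> convex hull S"
  proof -
    \<comment> \<open>The generators lie on the hyperplane of matrices of trace one.\<close>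
    have "S \<subseteq> {X. mat 1 \<bullet> X = 1}"
      by (auto simp: S_def Z_def inner_outer norm_eq_1)
    then have "convex hull S \<subseteq> {X. mat 1 \<bullet> X = 1}"
      by (intro hull_minimal) (auto simp: convex_hyperplane)
    then show ?thesis by auto
  qed
  then have "closed (conic hull (convex hull S))"
    using \<open>compact S\<close> by (simp add: closed_conic_hull_strong compact_convex_hull)
  ultimately show ?thesis
    by (simp only: convex_cone_hull_separate_nonempty[OF \<open>S \<noteq> {}\<close>])
qed

lemma completely_positive_symmetric:
  "X \<in> completely_positive \<Longrightarrow> X $ i $ j = X $ j $ i"
  by (induction rule: completely_positive_induct) auto

lemma copositive_iff_dual_completely_positive:
  fixes M :: "real^'k^'k"
  shows "M \<in> copositive \<longleftrightarrow> (\<forall>X\<in>completely_positive. 0 \<le> M \<bullet> X)"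
proof
  assume M: "M \<in> copositive"
  show "\<forall>X\<in>completely_positive. 0 \<le> M \<bullet> X"
  proof
    fix X :: "real^'k^'k" assume "X \<in> completely_positive"
    then show "0 \<le> M \<bullet> X"
      using M by (induction rule: completely_positive_induct)
        (auto simp: inner_add_right inner_outer copositive_def)
  qed
next
  assume "\<forall>X\<in>completely_positive. 0 \<le> M \<bullet> X"
  then show "M \<in> copositive"
    unfolding copositive_def by (auto simp: inner_outer[symmetric] outer_completely_positive)
qed

section \<open>The constraints as functionals on the lifted matrix\<close>

datatype 'n constr = Lin nat | Quad nat | Bin 'n | Corner

text \<open>
  Listing the normalisation of the last diagonal entry among the constraints, with right-hand side 1,
  turns the feasible lifted matrices into the intersection of a cone with an affine subspace, and
  \<open>\<gamma>\<close> into one more Lagrange multiplier.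
\<close>
definition constrs :: "nat \<Rightarrow> 'n set \<Rightarrow> 'n constr set"
  where "constrs m B = Lin ` {1..m} \<union> Quad ` {1..m} \<union> Bin ` B \<union> {Corner}"

fun constr_mat :: "(nat \<Rightarrow> real^'n) \<Rightarrow> 'n::finite constr \<Rightarrow> real^('n + 1)^('n + 1)" where
  "constr_mat A (Lin i) = lin_mat (A i)"
| "constr_mat A (Quad i) = quad_mat (A i)"
| "constr_mat A (Bin j) = bin_mat j"
| "constr_mat A Corner = corner_mat"

fun constr_rhs :: "(nat \<Rightarrow> real) \<Rightarrow> 'n constr \<Rightarrow> real" where
  "constr_rhs b (Lin i) = b i"
| "constr_rhs b (Quad i) = (b i)\<^sup>2"
| "constr_rhs b (Bin j) = 0"
| "constr_rhs b Corner = 1"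

lemma ball_constrs:
  "(\<forall>k\<in>constrs m B. P k) \<longleftrightarrow>
     (\<forall>i\<in>{1..m}. P (Lin i) \<and> P (Quad i)) \<and> (\<forall>j\<in>B. P (Bin j)) \<and> P Corner"
  unfolding constrs_def by blast

lemma sum_constrs:
  fixes B :: "'n::finite set"
  shows "sum f (constrs m B) =
    (\<Sum>i=1..m. f (Lin i)) + (\<Sum>i=1..m. f (Quad i)) + (\<Sum>j\<in>B. f (Bin j)) + f Corner"
proof -
  have "sum f (constrs m B) =
    sum f (Lin ` {1..m}) + sum f (Quad ` {1..m}) + sum f (Bin ` B) + sum f {Corner}"
    unfolding constrs_def by (subst sum.union_disjoint; auto)+
  then show ?thesis by (simp add: sum.reindex inj_on_def)
qed

lemma sum_UNIV_extend: "(\<Sum>i\<in>(UNIV :: ('n::finite + 1) set). f i) = (\<Sum>i\<in>UNIV. f (Inl i)) + f (Inr 1)"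
  by (simp add: sum.Plus UNIV_1 flip: UNIV_Plus_UNIV)

definition head :: "real^('n + 1) \<Rightarrow> real^'n::finite"
  where "head z = (\<chi> i. z $ Inl i)"

lemma lin_mat_outer: "lin_mat a \<bullet> outer z = z $ Inr 1 * (a \<bullet> head z)"
  unfolding inner_vec_def sum_UNIV_extend
  by (simp add: lin_mat_def block_def head_def sum_distrib_left mult_ac flip: sum.distrib)

lemma quad_mat_outer: "quad_mat a \<bullet> outer z = (a \<bullet> head z)\<^sup>2"
  unfolding inner_vec_def sum_UNIV_extend
  by (simp add: quad_mat_def block_def head_def power2_eq_square sum_product mult_ac)

text \<open>
  The equation \<open>x\<^sub>j = x\<^sub>j\<^sup>2\<close> equates the linear and the quadratic functional of the unit vector \<open>e\<^sub>j\<close>.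
\<close>
lemma bin_mat_eq: "bin_mat j = lin_mat (axis j 1) - quad_mat (axis j 1)"
  by (simp add: vec_eq_iff bin_mat_def lin_mat_def quad_mat_def block_def Let_def split: sum.split)

lemma bin_mat_outer:
  fixes j :: "'n::finite"
  shows "bin_mat j \<bullet> outer z = z $ Inl j * z $ Inr 1 - (z $ Inl j)\<^sup>2"
  by (simp add: bin_mat_eq inner_diff_left lin_mat_outer quad_mat_outer inner_axis' head_def)

lemma corner_mat_inner: "corner_mat \<bullet> Y = Y $ Inr 1 $ Inr 1"
  unfolding inner_vec_def sum_UNIV_extend
  by (simp add: corner_mat_def block_def mat_def)

lemma lifted_corner: "lifted X x $ Inr 1 $ Inr 1 = 1"
  by (simp add: lifted_def block_def mat_def)

lemma cpp_feasible_iff: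
  "(X, x) \<in> cpp_feasible m A b B \<longleftrightarrow>
     lifted X x \<in> completely_positive \<and>
     (\<forall>k\<in>constrs m B. constr_mat A k \<bullet> lifted X x = constr_rhs b k)"
  unfolding cpp_feasible_def ball_constrs
  by (auto simp: frob_eq_inner corner_mat_inner lifted_corner)

lemma completely_positive_eq_lifted:
  fixes Y :: "real^('n::finite + 1)^('n + 1)"
  assumes "Y \<in> completely_positive" "corner_mat \<bullet> Y = 1"
  obtains X x where "Y = lifted X x"
proof -
  have "Y = lifted (\<chi> i j. Y $ Inl i $ Inl j) (\<chi> i. Y $ Inl i $ Inr 1)"
    using assms completely_positive_symmetric[OF assms(1)]
    by (simp add: vec_eq_iff lifted_def block_def mat_def
        corner_mat_inner split: sum.split)
  then show ?thesis by (rule that)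
qed

lemma dual_mat_eq:
  "dual_mat Q c m A B (\<lambda>i. \<mu> (Lin i)) (\<lambda>i. \<mu> (Quad i)) (\<lambda>j. \<mu> (Bin j)) (\<mu> Corner)
     = obj_mat Q c - (\<Sum>k\<in>constrs m B. \<mu> k *\<^sub>R constr_mat A k)"
  by (simp add: dual_mat_def sum_constrs algebra_simps)

lemma cop_obj_eq:
  "cop_obj m b (\<lambda>i. \<mu> (Lin i), \<lambda>i. \<mu> (Quad i), \<lambda>j. \<mu> (Bin j), \<mu> Corner)
     = (\<Sum>k\<in>constrs m (B :: 'n::finite set). \<mu> k * constr_rhs b k)"
  by (simp add: cop_obj_def sum_constrs sum.distrib)

section \<open>Duality between the two programs\<close>

text \<open>
  If \<open>r\<close> were nonzero, a long enough step in the direction \<open>r\<close> from a feasible point would leave the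
  ball that contains the feasible region, although it keeps all constraints satisfied.
\<close>
lemma mbqp_recession_trivial:
  fixes r :: "real^'n::finite"
  assumes "mbqp_feasible m A b B \<noteq> {}" "bounded (mbqp_feasible m A b B)"
    and r: "nonneg_vec r" "\<And>i. i \<in> {1..m} \<Longrightarrow> A i \<bullet> r = 0" "\<And>j. j \<in> B \<Longrightarrow> r $ j = 0"
  shows "r = 0"
proof (rule ccontr)
  assume "r \<noteq> 0"
  obtain x where x: "x \<in> mbqp_feasible m A b B" using assms(1) by blast
  obtain \<beta> where \<beta>: "\<And>y. y \<in> mbqp_feasible m A b B \<Longrightarrow> norm y \<le> \<beta>"
    using assms(2) by (auto simp: bounded_iff)
  \<comment> \<open>This step has length \<open>\<beta> + norm x + 1\<close>, so its endpoint has norm at least \<open>\<beta> + 1\<close>.\<close>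
  define t where "t = (\<beta> + norm x + 1) / norm r"
  have "0 \<le> \<beta>" using \<beta>[OF x] norm_ge_zero[of x] by linarith
  then have t: "0 \<le> t" by (simp add: t_def)
  have "x + t *\<^sub>R r \<in> mbqp_feasible m A b B"
    using x r t by (auto simp: mbqp_feasible_def nonneg_vec_def inner_add_right)
  then have "norm (x + t *\<^sub>R r) \<le> \<beta>" by (rule \<beta>)
  moreover have "norm (t *\<^sub>R r) = \<beta> + norm x + 1"
    using \<open>0 \<le> \<beta>\<close> \<open>r \<noteq> 0\<close> norm_ge_zero[of x] by (simp add: t_def)
  ultimately show False
    using norm_triangle_ineq4[of "x + t *\<^sub>R r" x] by simp
qed

text \<open>
  The corner and quadratic functionals are sums of squares over the rank-one summands of \<open>Y\<close>, and so
  is the negative of a binary functional once the last entries are known to vanish. Each square is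
  therefore 0, which leaves vectors that are recession directions of the mixed-binary program.
\<close>
lemma cpp_kernel_trivial:
  fixes Y :: "real^('n::finite + 1)^('n + 1)"
  assumes "mbqp_feasible m A b B \<noteq> {}" "bounded (mbqp_feasible m A b B)"
    and "Y \<in> completely_positive" and Y0: "\<forall>k\<in>constrs m B. constr_mat A k \<bullet> Y = 0"
  shows "Y = 0"
proof -
  obtain K and x :: "nat \<Rightarrow> real^('n + 1)" where x: "\<forall>k<K. nonneg_vec (x k)" "Y = (\<Sum>k<K. outer (x k))"
    using assms(3) by (auto simp: completely_positive_def)
  have "(\<Sum>k<K. (x k $ Inr 1)\<^sup>2) = 0"
    using Y0 by (simp add: ball_constrs x(2) inner_sum_right corner_mat_inner power2_eq_square)
  then have last0: "x k $ Inr 1 = 0" if "k < K" for k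
    using that by (simp add: sum_nonneg_eq_0_iff)
  have A0: "A i \<bullet> head (x k) = 0" if "i \<in> {1..m}" "k < K" for i k
  proof -
    have "(\<Sum>k<K. (A i \<bullet> head (x k))\<^sup>2) = 0"
      using Y0 that(1) by (simp add: ball_constrs x(2) inner_sum_right quad_mat_outer)
    then show ?thesis using that(2) by (simp add: sum_nonneg_eq_0_iff)
  qed
  have B0: "head (x k) $ j = 0" if "j \<in> B" "k < K" for j k
  proof -
    have "(\<Sum>k<K. (x k $ Inl j)\<^sup>2) = - (bin_mat j \<bullet> Y)"
      by (simp add: x(2) inner_sum_right bin_mat_outer last0 sum_negf)
    also have "\<dots> = 0" using Y0 that(1) by (simp add: ball_constrs)
    finally show ?thesis using that(2) by (simp add: sum_nonneg_eq_0_iff head_def)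
  qed
  have "x k = 0" if "k < K" for k
  proof -
    have "head (x k) = 0"
      using x(1) that A0 B0
      by (intro mbqp_recession_trivial[OF assms(1,2)]) (auto simp: nonneg_vec_def head_def)
    then show ?thesis
      using last0[OF that] by (simp add: vec_eq_iff head_def split_sum_all)
  qed
  then show ?thesis by (simp add: x(2) vec_eq_iff)
qed

text \<open>
  A feasible \<open>x\<close> of the mixed-binary program lifts to the rank-one matrix of \<open>(x, 1)\<close>.
\<close>
lemma cpp_nonempty:
  fixes B :: "'n::finite set"
  assumes "mbqp_feasible m A b B \<noteq> {}"
  obtains Y where "Y \<in> completely_positive"
    "\<forall>k\<in>constrs m B. constr_mat A k \<bullet> Y = constr_rhs b k"
proof -
  obtain x where x: "x \<in> mbqp_feasible m A b B" using assms by blast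
  define z :: "real^('n + 1)" where "z = (\<chi> i. case i of Inl j \<Rightarrow> x $ j | Inr _ \<Rightarrow> 1)"
  have z: "z $ Inl j = x $ j" "z $ Inr 1 = 1" "head z = x" for j
    by (simp_all add: z_def head_def vec_eq_iff)
  have "nonneg_vec z"
    using x by (simp add: z_def nonneg_vec_def mbqp_feasible_def split: sum.split)
  then have "outer z \<in> completely_positive" by (rule outer_completely_positive)
  moreover have "\<forall>k\<in>constrs m B. constr_mat A k \<bullet> outer z = constr_rhs b k"
    using x by (auto simp: ball_constrs lin_mat_outer quad_mat_outer bin_mat_outer
        corner_mat_inner z mbqp_feasible_def power2_eq_square)
  ultimately show ?thesis by (rule that)
qed

lemma cpp_cop_weak_duality:
  assumes p: "p \<in> cpp_feasible m A b B" and q: "q \<in> cop_feasible Q c m A B"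
  shows "cop_obj m b q \<le> cpp_obj Q c p"
proof -
  obtain X x where p_eq: "p = (X, x)" by (cases p)
  obtain \<mu>l \<mu>q \<nu> \<gamma> where q_eq: "q = (\<mu>l, \<mu>q, \<nu>, \<gamma>)" by (cases q)
  define \<mu> where "\<mu> k = (case k of Lin i \<Rightarrow> \<mu>l i | Quad i \<Rightarrow> \<mu>q i | Bin j \<Rightarrow> \<nu> j | Corner \<Rightarrow> \<gamma>)" for k
  have "obj_mat Q c - (\<Sum>k\<in>constrs m B. \<mu> k *\<^sub>R constr_mat A k) \<in> copositive"
    using q dual_mat_eq[of Q c m A B \<mu>] by (simp add: q_eq cop_feasible_def \<mu>_def)
  moreover have Y: "lifted X x \<in> completely_positive"
    "\<forall>k\<in>constrs m B. constr_mat A k \<bullet> lifted X x = constr_rhs b k"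
    using p by (simp_all add: p_eq cpp_feasible_iff)
  ultimately have "0 \<le> (obj_mat Q c - (\<Sum>k\<in>constrs m B. \<mu> k *\<^sub>R constr_mat A k)) \<bullet> lifted X x"
    by (simp add: copositive_iff_dual_completely_positive)
  also have "\<dots> = cpp_obj Q c p - (\<Sum>k\<in>constrs m B. \<mu> k * constr_rhs b k)"
    using Y(2) by (simp add: inner_diff_left inner_sum_left cpp_obj_def p_eq frob_eq_inner)
  also have "(\<Sum>k\<in>constrs m B. \<mu> k * constr_rhs b k) = cop_obj m b q"
    using cop_obj_eq[of m b \<mu> B] by (simp add: q_eq \<mu>_def)
  finally show ?thesis by simp
qed

theorem theorem3p1:
  fixes Q :: "real^'n^'n" and c :: "real^'n"
    and m :: nat and A :: "nat \<Rightarrow> real^'n" and b :: "nat \<Rightarrow> real"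
    and B :: "('n::finite) set"
  assumes "transpose Q = Q"
    and "mbqp_feasible m A b B \<noteq> {}"
    and "bounded (mbqp_feasible m A b B)"
  shows "(\<exists>p\<in>cpp_feasible m A b B. ereal (cpp_obj Q c p) = cpp_value Q c m A b B)
       \<and> cpp_value Q c m A b B = cop_value Q c m A b B"
proof -
  let ?I = "constrs m B" and ?C = "constr_mat A" and ?d = "constr_rhs b" and ?O = "obj_mat Q c"
  obtain Y0 where Y0: "Y0 \<in> completely_positive" "\<forall>k\<in>?I. ?C k \<bullet> Y0 = ?d k"
    using cpp_nonempty[OF assms(2)] .
  have "finite ?I" by (simp add: constrs_def)
  have ker: "\<forall>Y\<in>completely_positive. (\<forall>k\<in>?I. ?C k \<bullet> Y = 0) \<longrightarrow> Y = 0"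
    using cpp_kernel_trivial[OF assms(2,3)] by blast
  obtain Ymin where Ymin: "Ymin \<in> completely_positive" "\<forall>k\<in>?I. ?C k \<bullet> Ymin = ?d k"
    and min: "\<forall>Y\<in>completely_positive. (\<forall>k\<in>?I. ?C k \<bullet> Y = ?d k) \<longrightarrow> ?O \<bullet> Ymin \<le> ?O \<bullet> Y"
    and dual: "\<forall>e>0.
      \<exists>\<mu>. (\<forall>Y\<in>completely_positive. 0 \<le> (?O - (\<Sum>k\<in>?I. \<mu> k *\<^sub>R ?C k)) \<bullet> Y)
        \<and> ?O \<bullet> Ymin - e < (\<Sum>k\<in>?I. \<mu> k * ?d k)"
    by (rule conic_strong_duality[OF closed_completely_positive convex_cone_completely_positive
          \<open>finite ?I\<close> ker Y0, where obj = ?O])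
  have "corner_mat \<bullet> Ymin = 1" using Ymin(2) by (simp add: ball_constrs)
  with Ymin(1) obtain X x where lift: "Ymin = lifted X x" by (rule completely_positive_eq_lifted)
  have feas: "(X, x) \<in> cpp_feasible m A b B" using Ymin by (simp add: cpp_feasible_iff lift)
  have obj: "cpp_obj Q c (X, x) = ?O \<bullet> Ymin" by (simp add: cpp_obj_def frob_eq_inner lift)
  have val: "cpp_value Q c m A b B = ereal (cpp_obj Q c (X, x))"
    unfolding cpp_value_def
  proof (rule antisym)
    show "(INF p\<in>cpp_feasible m A b B. ereal (cpp_obj Q c p)) \<le> ereal (cpp_obj Q c (X, x))"
      using feas by (rule INF_lower)
    show "ereal (cpp_obj Q c (X, x)) \<le> (INF p\<in>cpp_feasible m A b B. ereal (cpp_obj Q c p))"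
      unfolding obj by (rule INF_greatest)
        (auto simp: cpp_feasible_iff cpp_obj_def frob_eq_inner min)
  qed
  have "cop_value Q c m A b B \<le> ereal (cpp_obj Q c (X, x))"
    unfolding cop_value_def using cpp_cop_weak_duality[OF feas] by (intro SUP_least) simp
  moreover have "ereal (cpp_obj Q c (X, x)) \<le> cop_value Q c m A b B"
  proof (rule ereal_le_epsilon2)
    fix e :: real assume "0 < e"
    with dual obtain \<mu> where
      \<mu>: "\<forall>Y\<in>completely_positive. 0 \<le> (?O - (\<Sum>k\<in>?I. \<mu> k *\<^sub>R ?C k)) \<bullet> Y"
        "?O \<bullet> Ymin - e < (\<Sum>k\<in>?I. \<mu> k * ?d k)" by blast
    let ?q = "(\<lambda>i. \<mu> (Lin i), \<lambda>i. \<mu> (Quad i), \<lambda>j. \<mu> (Bin j), \<mu> Corner)"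
    have "?q \<in> cop_feasible Q c m A B"
      using \<mu>(1) by (simp add: cop_feasible_def dual_mat_eq copositive_iff_dual_completely_positive)
    then have le: "ereal (cop_obj m b ?q) \<le> cop_value Q c m A b B"
      unfolding cop_value_def by (rule SUP_upper)
    have "?O \<bullet> Ymin \<le> cop_obj m b ?q + e"
      using \<mu>(2) unfolding cop_obj_eq[of m b \<mu> B] by simp
    then have "ereal (cpp_obj Q c (X, x)) \<le> ereal (cop_obj m b ?q) + ereal e"
      by (simp add: obj)
    also have "\<dots> \<le> cop_value Q c m A b B + ereal e"
      using le by (rule add_right_mono)
    finally show "ereal (cpp_obj Q c (X, x)) \<le> cop_value Q c m A b B + ereal e" .
  qed
  ultimately show ?thesis using feas val by (auto intro: antisym)
qed

end
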